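(* On the class of linear orders, $\mathrm{FO}^3(<,\mathrm{succ},\mathrm{min},\mathrm{max})$-sentences are $O(m^4)$-succinct in $\mathrm{FO}^2(<)$-sentences. That is, there is a function $f\colon\mathbb{N}\to\mathbb{N}$ with $f(m)=O(m^4)$ such that for every $\mathrm{FO}^3(<,\mathrm{succ},\mathrm{min},\mathrm{max})$-sentence $\psi$ there is an $\mathrm{FO}^2(<)$-sentence $\chi$ with $|\chi|\le f(|\psi|)$ such that for all $N\in\mathbb{N}$: $\mathcal{A}_N\models\chi$ iff $\mathcal{A}_N\models\psi$.
   Context: For $N\in\mathbb{N}$, $\mathcal{A}_N$ is the structure with universe $\{0,\dots,N\}$, $<$ the natural linear order, $\mathrm{succ}=\{(a,a+1): 0\le a<N\}$, and constants $\mathrm{min}=0$, $\mathrm{max}=N$; the class of linear orders is identified with $\{\mathcal{A}_N : N\in\mathbb{N}\}$ (sentences of signature $\{<\}$ are evaluated in the $\{<\}$-reduct). $\mathrm{FO}^k$ denotes the $k$-variable fragment of first-order logic (formulas using only $k$ distinct variables, which may be requantified). $\mathrm{FO}^3(<,\mathrm{succ},\mathrm{min},\mathrm{max})$ is the set of $\mathrm{FO}^3$-formulas over signature $\{<,\mathrm{succ},\mathrm{min},\mathrm{max}\}$ (binary relation symbols $<,\mathrm{succ}$, constants $\mathrm{min},\mathrm{max}$); $\mathrm{FO}^2(<)$ is the set of $\mathrm{FO}^2$-formulas over signature $\{<\}$. The size $|\varphi|$ of a formula is the number of nodes of its syntax tree (leaves are atomic formulas, inner nodes are Boolean connectives or quantifiers).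 *)

theory Defs
  imports Complex_Main "HOL-Library.Landau_Symbols"
begin

datatype symbol = LessSym | SuccSym | MinSym | MaxSym

datatype trm = Var nat | Min | Max

datatype fm =
    Eq trm trm
  | Less trm trm
  | Succ trm trm
  | Neg fm
  | Conj fm fm
  | Disj fm fm
  | Ex nat fm
  | All nat fm

fun fm_size :: "fm \<Rightarrow> nat" where
  "fm_size (Eq s t) = 1"
| "fm_size (Less s t) = 1"
| "fm_size (Succ s t) = 1"
| "fm_size (Neg \<phi>) = 1 + fm_size \<phi>"
| "fm_size (Conj \<phi> \<psi>) = 1 + fm_size \<phi> + fm_size \<psi>"
| "fm_size (Disj \<phi> \<psi>) = 1 + fm_size \<phi> + fm_size \<psi>"
| "fm_size (Ex x \<phi>) = 1 + fm_size \<phi>"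
| "fm_size (All x \<phi>) = 1 + fm_size \<phi>"

fun trm_vars :: "trm \<Rightarrow> nat set" where
  "trm_vars (Var x) = {x}"
| "trm_vars Min = {}"
| "trm_vars Max = {}"

text \<open>All variables occurring in a formula, free, bound, or merely quantified.\<close>

fun fm_vars :: "fm \<Rightarrow> nat set" where
  "fm_vars (Eq s t) = trm_vars s \<union> trm_vars t"
| "fm_vars (Less s t) = trm_vars s \<union> trm_vars t"
| "fm_vars (Succ s t) = trm_vars s \<union> trm_vars t"
| "fm_vars (Neg \<phi>) = fm_vars \<phi>"
| "fm_vars (Conj \<phi> \<psi>) = fm_vars \<phi> \<union> fm_vars \<psi>"
| "fm_vars (Disj \<phi> \<psi>) = fm_vars \<phi> \<union> fm_vars \<psi>"
| "fm_vars (Ex x \<phi>) = insert x (fm_vars \<phi>)"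
| "fm_vars (All x \<phi>) = insert x (fm_vars \<phi>)"

fun free_vars :: "fm \<Rightarrow> nat set" where
  "free_vars (Eq s t) = trm_vars s \<union> trm_vars t"
| "free_vars (Less s t) = trm_vars s \<union> trm_vars t"
| "free_vars (Succ s t) = trm_vars s \<union> trm_vars t"
| "free_vars (Neg \<phi>) = free_vars \<phi>"
| "free_vars (Conj \<phi> \<psi>) = free_vars \<phi> \<union> free_vars \<psi>"
| "free_vars (Disj \<phi> \<psi>) = free_vars \<phi> \<union> free_vars \<psi>"
| "free_vars (Ex x \<phi>) = free_vars \<phi> - {x}"
| "free_vars (All x \<phi>) = free_vars \<phi> - {x}"

fun trm_symbols :: "trm \<Rightarrow> symbol set" where
  "trm_symbols (Var x) = {}"
| "trm_symbols Min = {MinSym}"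
| "trm_symbols Max = {MaxSym}"

text \<open>Equality is a logical symbol, so it belongs to every signature.\<close>

fun fm_symbols :: "fm \<Rightarrow> symbol set" where
  "fm_symbols (Eq s t) = trm_symbols s \<union> trm_symbols t"
| "fm_symbols (Less s t) = insert LessSym (trm_symbols s \<union> trm_symbols t)"
| "fm_symbols (Succ s t) = insert SuccSym (trm_symbols s \<union> trm_symbols t)"
| "fm_symbols (Neg \<phi>) = fm_symbols \<phi>"
| "fm_symbols (Conj \<phi> \<psi>) = fm_symbols \<phi> \<union> fm_symbols \<psi>"
| "fm_symbols (Disj \<phi> \<psi>) = fm_symbols \<phi> \<union> fm_symbols \<psi>"
| "fm_symbols (Ex x \<phi>) = fm_symbols \<phi>"
| "fm_symbols (All x \<phi>) = fm_symbols \<phi>"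

definition FO_formulas :: "nat \<Rightarrow> symbol set \<Rightarrow> fm set" where
  "FO_formulas k \<sigma> = {\<phi>. card (fm_vars \<phi>) \<le> k \<and> fm_symbols \<phi> \<subseteq> \<sigma>}"

definition FO_sentences :: "nat \<Rightarrow> symbol set \<Rightarrow> fm set" where
  "FO_sentences k \<sigma> = {\<phi> \<in> FO_formulas k \<sigma>. free_vars \<phi> = {}}"

record 'a struct =
  univ :: "'a set"
  less_rel :: "('a \<times> 'a) set"
  succ_rel :: "('a \<times> 'a) set"
  min_const :: 'a
  max_const :: 'a

fun trm_val :: "'a struct \<Rightarrow> (nat \<Rightarrow> 'a) \<Rightarrow> trm \<Rightarrow> 'a" where
  "trm_val A e (Var x) = e x"
| "trm_val A e Min = min_const A"
| "trm_val A e Max = max_const A"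

fun sat :: "'a struct \<Rightarrow> (nat \<Rightarrow> 'a) \<Rightarrow> fm \<Rightarrow> bool" where
  "sat A e (Eq s t) \<longleftrightarrow> trm_val A e s = trm_val A e t"
| "sat A e (Less s t) \<longleftrightarrow> (trm_val A e s, trm_val A e t) \<in> less_rel A"
| "sat A e (Succ s t) \<longleftrightarrow> (trm_val A e s, trm_val A e t) \<in> succ_rel A"
| "sat A e (Neg \<phi>) \<longleftrightarrow> \<not> sat A e \<phi>"
| "sat A e (Conj \<phi> \<psi>) \<longleftrightarrow> sat A e \<phi> \<and> sat A e \<psi>"
| "sat A e (Disj \<phi> \<psi>) \<longleftrightarrow> sat A e \<phi> \<or> sat A e \<psi>"
| "sat A e (Ex x \<phi>) \<longleftrightarrow> (\<exists>a \<in> univ A. sat A (e(x := a)) \<phi>)"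
| "sat A e (All x \<phi>) \<longleftrightarrow> (\<forall>a \<in> univ A. sat A (e(x := a)) \<phi>)"

text \<open>
  Intended for sentences, whose truth value does not depend on the assignment. A sentence not
  mentioning a symbol has the same value in a structure as in the reduct forgetting that symbol.
\<close>

definition models :: "'a struct \<Rightarrow> fm \<Rightarrow> bool" (infix "\<Turnstile>" 50) where
  "A \<Turnstile> \<phi> \<longleftrightarrow> (\<forall>e. range e \<subseteq> univ A \<longrightarrow> sat A e \<phi>)"

definition lin_order :: "nat \<Rightarrow> nat struct" where
  "lin_order N =
    \<lparr> univ = {0..N},
      less_rel = {(a, b). a < b \<and> b \<le> N},
      succ_rel = {(a, a + 1) | a. a < N},
      min_const = 0,
      max_const = N \<rparr>"

end

theory Submission
  imports Defs
begin

text \<open>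
  A formula over the variables \<open>x, y, z\<close> of size \<open>s\<close> cannot tell apart two assignments whose
  pairwise signed distances agree up to certain thresholds: centre thresholds \<open>d\<close> between variables,
  a border threshold \<open>l\<close> between a variable and an endpoint, and \<open>2 * l\<close> between the endpoints.
  With \<open>c\<close> the sum of the three centre thresholds, \<open>c\<^sup>2 + 2 * l \<le> (4 * s)\<^sup>2\<close> can be maintained by
  induction. Quantifying over \<open>z\<close> replaces the threshold of \<open>x, y\<close> by at most the sum of those of
  \<open>x, z\<close> and \<open>z, y\<close> plus \<open>1\<close>, and \<open>l\<close> by \<open>l + c + 1\<close>. With three variables no other centre threshold
  survives, so \<open>c\<close> grows by at most \<open>1\<close> and the square root of \<open>c\<^sup>2 + 2 * l\<close> by at most \<open>2\<close>.
  Hence the truth value of a sentence of size \<open>m\<close> is constant on all orders with \<open>N > 16 * m\<^sup>2\<close>, and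
  a case distinction on \<open>N\<close> up to that bound, each case of size \<open>O(m\<^sup>2)\<close>, is an equivalent
  two-variable sentence.
\<close>

section \<open>Distances up to a threshold\<close>

text \<open>Equality of \<open>s\<close> and \<open>t\<close> after truncation to the interval from
  \<open>- k - 1\<close> to \<open>k + 1\<close>.\<close>

definition close :: "nat \<Rightarrow> int \<Rightarrow> int \<Rightarrow> bool" where
  "close k s t \<longleftrightarrow> s = t \<or> int k < s \<and> int k < t \<or> s < - int k \<and> t < - int k"

lemma close_mono: "close k s t \<Longrightarrow> k' \<le> k \<Longrightarrow> close k' s t"
  by (auto simp: close_def)

lemma close_diff_swap: "close k (a - b) (a' - b') \<Longrightarrow> close k (b - a) (b' - a')"
  by (auto simp: close_def)

lemma close_sym: "close k s t \<Longrightarrow> close k t s"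
  by (auto simp: close_def)

text \<open>If \<open>a\<close> is within the threshold of some \<open>p i\<close>, its exact offset
  is copied to \<open>q i\<close>. Otherwise \<open>a\<close> lies in a gap between points, and the
  premise keeps the corresponding gap for \<open>b\<close> wide enough.\<close>

lemma close_extend:
  fixes p q :: "'i \<Rightarrow> int" and a :: int
  assumes fin: "finite P"
    and cl: "\<And>i j. i \<in> P \<Longrightarrow> j \<in> P \<Longrightarrow> i \<noteq> j \<Longrightarrow> close (k i + k j + 1) (p i - p j) (q i - q j)"
  shows "\<exists>b. \<forall>i\<in>P. close (k i) (a - p i) (b - q i)"
proof (cases "\<exists>i\<in>P. \<bar>a - p i\<bar> \<le> int (k i)")
  case True
  then obtain i where i: "i \<in> P" "\<bar>a - p i\<bar> \<le> int (k i)" by blast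
  \<comment> \<open>Both differences in \<open>cl\<close> are shifted by the same amount, at most
    \<open>k i\<close>, so a threshold of at least \<open>k j\<close> remains.\<close>
  have "close (k j) (a - p j) (q i + (a - p i) - q j)" if "j \<in> P" for j
  proof (cases "i = j")
    case False
    show ?thesis using cl[OF i(1) that False] i(2) unfolding close_def by linarith
  qed (simp add: close_def)
  then show ?thesis by blast
next
  case False
  then have far: "\<bar>a - p i\<bar> > int (k i)" if "i \<in> P" for i using that by force
  define L where "L = (\<lambda>i. q i + int (k i) + 1) ` {i\<in>P. p i < a}"
  define R where "R = (\<lambda>i. q i - int (k i) - 1) ` {i\<in>P. a < p i}"
  have finLR: "finite L" "finite R" using fin by (auto simp: L_def R_def)
  \<comment> \<open>Here \<open>p j - p i\<close> is at least \<open>k i + k j + 2\<close>, just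
    beyond the threshold of \<open>cl\<close>, so \<open>q j - q i\<close> is at least
    \<open>k i + k j + 2\<close> as well. This is where the summand 1 enters.\<close>
  have LR: "u \<le> v" if uv: "u \<in> L" "v \<in> R" for u v
  proof -
    obtain i where i: "i \<in> P" "p i < a" "u = q i + int (k i) + 1" using uv by (auto simp: L_def)
    obtain j where j: "j \<in> P" "a < p j" "v = q j - int (k j) - 1" using uv by (auto simp: R_def)
    have "i \<noteq> j" using i j by auto
    from cl[OF i(1) j(1) this] far[OF i(1)] far[OF j(1)] i j
    show ?thesis unfolding close_def by linarith
  qed
  obtain b where b: "\<forall>u\<in>L. u \<le> b" "\<forall>v\<in>R. b \<le> v"
  proof (cases "L = {}")
    case True
    show ?thesis
    proof (cases "R = {}")
      case True
      then show ?thesis using \<open>L = {}\<close> that by blast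
    next
      case False
      then show ?thesis using \<open>L = {}\<close> that[of "linorder_class.Min R"] finLR by auto
    qed
  next
    case False
    then show ?thesis using that[of "linorder_class.Max L"] finLR LR by auto
  qed
  have "close (k i) (a - p i) (b - q i)" if i: "i \<in> P" for i
  proof (cases "p i < a")
    case True
    then have "q i + int (k i) + 1 \<le> b" using b(1) i by (auto simp: L_def)
    then show ?thesis using far[OF i] True unfolding close_def by linarith
  next
    case False
    then have "a < p i" using far[OF i] by linarith
    moreover from this have "b \<le> q i - int (k i) - 1" using b(2) i by (auto simp: R_def)
    ultimately show ?thesis using far[OF i] unfolding close_def by linarith
  qed
  then show ?thesis by blast
qed

section \<open>Threshold equivalence of assignments\<close>

definition trms :: "nat set \<Rightarrow> trm set" where
  "trms V = {Min, Max} \<union> Var ` V"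

text \<open>
  For \<open>V = {u, v, w}\<close>, the threshold between \<open>u\<close> and \<open>v\<close> is stored as \<open>d w\<close>.
\<close>

fun threshold :: "nat set \<Rightarrow> (nat \<Rightarrow> nat) \<Rightarrow> nat \<Rightarrow> trm \<Rightarrow> trm \<Rightarrow> nat" where
  "threshold V d l (Var u) (Var v) = sum d (V - {u, v})"
| "threshold V d l (Var u) _ = l"
| "threshold V d l _ (Var v) = l"
| "threshold V d l _ _ = 2 * l"

text \<open>The bounds by \<open>N\<close> and \<open>M\<close> place the values in the universes,
  outside of which the atomic relations fail.\<close>

definition thr_equiv ::
  "nat set \<Rightarrow> (nat \<Rightarrow> nat) \<Rightarrow> nat \<Rightarrow> nat \<Rightarrow> (nat \<Rightarrow> nat) \<Rightarrow> nat \<Rightarrow> (nat \<Rightarrow> nat) \<Rightarrow> bool" where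
  "thr_equiv V d l N e M e' \<longleftrightarrow>
    (\<forall>s\<in>trms V. trm_val (lin_order N) e s \<le> N \<and> trm_val (lin_order M) e' s \<le> M) \<and>
    (\<forall>s\<in>trms V. \<forall>t\<in>trms V. close (threshold V d l s t)
      (int (trm_val (lin_order N) e s) - int (trm_val (lin_order N) e t))
      (int (trm_val (lin_order M) e' s) - int (trm_val (lin_order M) e' t)))"

lemma lin_order_simps [simp]:
  "univ (lin_order N) = {0..N}"
  "min_const (lin_order N) = 0"
  "max_const (lin_order N) = N"
  "(a, b) \<in> less_rel (lin_order N) \<longleftrightarrow> a < b \<and> b \<le> N"
  "(a, b) \<in> succ_rel (lin_order N) \<longleftrightarrow> b = a + 1 \<and> b \<le> N"
  by (auto simp: lin_order_def)

lemma threshold_sym: "threshold V d l s t = threshold V d l t s"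
  by (cases s; cases t) (auto simp: insert_commute)

lemma threshold_mono:
  assumes "\<And>w. w \<in> V \<Longrightarrow> d w \<le> d' w" "l \<le> l'"
  shows "threshold V d l s t \<le> threshold V d' l' s t"
  using assms by (cases s; cases t) (auto intro: sum_mono)

lemma thr_equiv_sym: "thr_equiv V d l N e M e' \<Longrightarrow> thr_equiv V d l M e' N e"
  by (auto simp: thr_equiv_def intro: close_sym)

lemma thr_equiv_mono:
  assumes "thr_equiv V d' l' N e M e'" "\<And>w. w \<in> V \<Longrightarrow> d w \<le> d' w" "l \<le> l'"
  shows "thr_equiv V d l N e M e'"
  using assms threshold_mono[of V d d' l l'] unfolding thr_equiv_def by (blast intro: close_mono)

lemma trm_in_trms: "trm_vars s \<subseteq> V \<Longrightarrow> s \<in> trms V"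
  by (cases s) (auto simp: trms_def)

lemma card_3_third:
  assumes "card V = 3" "x \<in> V" "u \<in> V" "u \<noteq> x"
  obtains v where "v \<noteq> x" "v \<noteq> u" "V = {x, u, v}"
proof -
  have "card (V - {x, u}) = 1" using assms by (subst card_Diff_subset) auto
  then obtain v where "V - {x, u} = {v}" by (auto simp: card_1_singleton_iff)
  then show ?thesis using assms that[of v] by blast
qed

text \<open>The old value of \<open>x\<close> is overwritten, so its centre thresholds drop to 0.
  The threshold between the other two variables, stored at \<open>x\<close>, must cover both its old
  value and the composition through \<open>x\<close>.\<close>

definition quant_centre :: "nat set \<Rightarrow> nat \<Rightarrow> (nat \<Rightarrow> nat) \<Rightarrow> nat \<Rightarrow> nat" where
  "quant_centre V x d w = (if w = x then max (d x) (sum d (V - {x}) + 1) else 0)"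

text \<open>Two variables are covered by \<open>quant_centre\<close>. A variable and an endpoint
  need at most \<open>l + sum d V + 1\<close>. Two endpoints need \<open>2 * l + 1\<close>, which
  explains their doubled threshold.\<close>

lemma threshold_quant:
  fixes d :: "nat \<Rightarrow> nat" and l :: nat
  assumes V: "card V = 3" "x \<in> V"
    and st: "s \<in> trms (V - {x})" "t \<in> trms (V - {x})" "s \<noteq> t"
  defines "k \<equiv> threshold V (quant_centre V x d) (l + sum d V + 1) s t"
  shows "threshold V d l (Var x) s + threshold V d l (Var x) t + 1 \<le> k"
    and "threshold V d l s t \<le> k"
proof -
  have fin: "finite V" using V(1) card.infinite by fastforce
  have le: "sum d (V - A) \<le> sum d V" for A using fin by (simp add: sum_mono2)
  have vars: "sum d (V - {x, u}) + sum d (V - {x, v}) + 1 \<le> sum (quant_centre V x d) (V - {u, v})"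
      "sum d (V - {u, v}) \<le> sum (quant_centre V x d) (V - {u, v})"
    if uv: "u \<in> V" "u \<noteq> x" "v \<in> V" "v \<noteq> x" "u \<noteq> v" for u v
  proof -
    obtain v' where v': "v' \<noteq> x" "v' \<noteq> u" "V = {x, u, v'}"
      using card_3_third[OF V uv(1,2)] by blast
    then have "v' = v" using uv by auto
    then have "V - {u, v} = {x}" "V - {x, u} = {v}" "V - {x, v} = {u}" "V - {x} = {u, v}"
      using v' uv by auto
    then show "sum d (V - {x, u}) + sum d (V - {x, v}) + 1 \<le> sum (quant_centre V x d) (V - {u, v})"
      "sum d (V - {u, v}) \<le> sum (quant_centre V x d) (V - {u, v})"
      using uv by (auto simp: quant_centre_def)
  qed
  show "threshold V d l (Var x) s + threshold V d l (Var x) t + 1 \<le> k"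
    using st le by (auto simp: k_def trms_def add.commute intro!: vars(1)[simplified])
  show "threshold V d l s t \<le> k"
    using st by (auto simp: k_def trms_def intro!: vars(2))
qed

text \<open>One move of an Ehrenfeucht-Fraisse game in which the pebble \<open>x\<close> is
  replaced: \<open>close_extend\<close> is applied to the remaining terms, endpoints
  included.\<close>

lemma thr_equiv_extend:
  assumes V: "card V = 3" "x \<in> V"
    and eq: "thr_equiv V (quant_centre V x d) (l + sum d V + 1) N e M e'"
    and a: "a \<le> N"
  shows "\<exists>b\<le>M. thr_equiv V d l N (e(x := a)) M (e'(x := b))"
proof -
  define P where "P = trms (V - {x})"
  define p where "p s = int (trm_val (lin_order N) e s)" for s
  define q where "q s = int (trm_val (lin_order M) e' s)" for s
  define k where "k = threshold V d l (Var x)"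
  have fin: "finite P" using V(1) card.infinite unfolding P_def trms_def by fastforce
  have PV: "P \<subseteq> trms V" by (auto simp: P_def trms_def)
  have cl: "close (threshold V (quant_centre V x d) (l + sum d V + 1) s t) (p s - p t) (q s - q t)"
    if "s \<in> P" "t \<in> P" for s t
    using eq that PV unfolding thr_equiv_def p_def q_def by blast
  obtain b where b: "\<And>s. s \<in> P \<Longrightarrow> close (k s) (int a - p s) (b - q s)"
  proof -
    have "close (k i + k j + 1) (p i - p j) (q i - q j)" if "i \<in> P" "j \<in> P" "i \<noteq> j" for i j
      using cl[OF that(1,2)] threshold_quant(1)[OF V] that unfolding k_def P_def
      by (blast intro: close_mono)
    then have "\<exists>b. \<forall>i\<in>P. close (k i) (int a - p i) (b - q i)" by (rule close_extend[OF fin])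
    then show ?thesis using that by blast
  qed
  \<comment> \<open>So far \<open>b\<close> is just an integer. Comparison with both endpoints
    preserves the signs of the differences and puts it between 0 and \<open>M\<close>.\<close>
  have "close (k Min) (int a - p Min) (b - q Min)" "close (k Max) (int a - p Max) (b - q Max)"
    by (auto intro!: b simp: P_def trms_def)
  then have b_bounds: "0 \<le> b" "b \<le> int M" using a by (auto simp: close_def p_def q_def)
  define b' where "b' = nat b"
  have b': "int b' = b" "b' \<le> M" using b_bounds by (auto simp: b'_def)
  have same: "int (trm_val (lin_order N) (e(x := a)) s) = p s"
    "int (trm_val (lin_order M) (e'(x := b')) s) = q s" if "s \<in> P" for s
    using that by (auto simp: P_def trms_def p_def q_def split: if_splits)
  have trms_V: "trms V = insert (Var x) P" using V(2) by (auto simp: P_def trms_def)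
  have x_close: "close (threshold V d l (Var x) s) (int a - p s) (int b' - q s)" if "s \<in> P" for s
    using b[OF that] by (simp add: k_def b')
  have P_close: "close (threshold V d l s t) (p s - p t) (q s - q t)" if "s \<in> P" "t \<in> P" for s t
  proof (cases "s = t")
    case False
    then show ?thesis
      using cl[OF that] threshold_quant(2)[OF V] that unfolding P_def by (blast intro: close_mono)
  qed (simp add: close_def)
  have "thr_equiv V d l N (e(x := a)) M (e'(x := b'))"
    unfolding thr_equiv_def
  proof (intro conjI ballI)
    fix s assume "s \<in> trms V"
    have "p s \<le> int N \<and> q s \<le> int M" if "s \<in> P"
      using eq that PV unfolding thr_equiv_def p_def q_def by auto
    then show "trm_val (lin_order N) (e(x := a)) s \<le> N" "trm_val (lin_order M) (e'(x := b')) s \<le> M"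
      using \<open>s \<in> trms V\<close> a b'(2) same[of s] unfolding trms_V by auto
  next
    fix s t assume "s \<in> trms V" "t \<in> trms V"
    then consider "s = Var x" "t = Var x" | "s = Var x" "t \<in> P" | "s \<in> P" "t = Var x" | "s \<in> P" "t \<in> P"
      unfolding trms_V by blast
    then show "close (threshold V d l s t)
      (int (trm_val (lin_order N) (e(x := a)) s) - int (trm_val (lin_order N) (e(x := a)) t))
      (int (trm_val (lin_order M) (e'(x := b')) s) - int (trm_val (lin_order M) (e'(x := b')) t))"
    proof cases
      case 1
      then show ?thesis by (simp add: close_def)
    next
      case 2
      then show ?thesis using x_close same by simp
    next
      case 3
      then have "close (threshold V d l (Var x) s) (p s - int a) (q s - int b')"
        using close_diff_swap x_close by blast
      then show ?thesis using 3 same by (simp add: threshold_sym[of V d l s])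
    next
      case 4
      then show ?thesis using P_close same by simp
    qed
  qed
  then show ?thesis using b'(2) by blast
qed

section \<open>Invariance of three-variable formulas\<close>

text \<open>Threshold 1 reveals the sign of a difference and whether it is 1 or -1, which is all
  that an atom asks.\<close>

lemma atom_invariant:
  assumes "thr_equiv V (\<lambda>_. 1) 1 N e M e'" "card V = 3" "trm_vars s \<subseteq> V" "trm_vars t \<subseteq> V"
  shows "sat (lin_order N) e (Eq s t) \<longleftrightarrow> sat (lin_order M) e' (Eq s t)"
    and "sat (lin_order N) e (Less s t) \<longleftrightarrow> sat (lin_order M) e' (Less s t)"
    and "sat (lin_order N) e (Succ s t) \<longleftrightarrow> sat (lin_order M) e' (Succ s t)"
proof -
  have s: "s \<in> trms V" and t: "t \<in> trms V" using assms trm_in_trms by auto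
  \<comment> \<open>Some index remains outside \<open>{u, v}\<close>, so every centre threshold is
    at least 1.\<close>
  have "card (V - {u, v}) \<ge> 1" for u v
    using diff_card_le_card_Diff[of "{u, v}" V] card_insert_le_m1[of 2 "{v}" u] assms(2)
    by (auto simp: numeral_eq_Suc)
  then have "1 \<le> threshold V (\<lambda>_. 1) 1 s t" by (cases s; cases t) auto
  with assms(1) s t have "close 1
      (int (trm_val (lin_order N) e s) - int (trm_val (lin_order N) e t))
      (int (trm_val (lin_order M) e' s) - int (trm_val (lin_order M) e' t))"
    unfolding thr_equiv_def by (blast intro: close_mono)
  moreover have "trm_val (lin_order N) e t \<le> N" "trm_val (lin_order M) e' t \<le> M"
    using assms(1) t unfolding thr_equiv_def by auto
  ultimately show "sat (lin_order N) e (Eq s t) \<longleftrightarrow> sat (lin_order M) e' (Eq s t)"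
    "sat (lin_order N) e (Less s t) \<longleftrightarrow> sat (lin_order M) e' (Less s t)"
    "sat (lin_order N) e (Succ s t) \<longleftrightarrow> sat (lin_order M) e' (Succ s t)"
    by (auto simp: close_def)
qed

text \<open>\<open>W\<close> bounds the square root of the cost: on this scale binary connectives
  add up and a quantifier costs a constant.\<close>

definition invariant_fm :: "nat set \<Rightarrow> nat \<Rightarrow> fm \<Rightarrow> bool" where
  "invariant_fm V W \<phi> \<longleftrightarrow> (\<exists>d l. (sum d V)\<^sup>2 + 2 * l \<le> W\<^sup>2 \<and>
    (\<forall>N e M e'. thr_equiv V d l N e M e' \<longrightarrow> sat (lin_order N) e \<phi> = sat (lin_order M) e' \<phi>))"

lemma invariant_fmI:
  assumes "(sum d V)\<^sup>2 + 2 * l \<le> W\<^sup>2"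
    and "\<And>N e M e'. thr_equiv V d l N e M e' \<Longrightarrow>
      sat (lin_order N) e \<phi> = sat (lin_order M) e' \<phi>"
  shows "invariant_fm V W \<phi>"
  using assms unfolding invariant_fm_def by blast

lemma invariant_fm_atom:
  assumes "card V = 3" "trm_vars s \<subseteq> V" "trm_vars t \<subseteq> V"
  shows "invariant_fm V 4 (Eq s t)" "invariant_fm V 4 (Less s t)" "invariant_fm V 4 (Succ s t)"
proof -
  \<comment> \<open>Three centre thresholds 1 and border threshold 1 cost 9 + 2 = 11 \<le>
    16.\<close>
  have weight: "(\<Sum>_\<in>V. 1)\<^sup>2 + 2 * 1 \<le> (4 :: nat)\<^sup>2" using assms(1) by simp
  show "invariant_fm V 4 (Eq s t)" "invariant_fm V 4 (Less s t)" "invariant_fm V 4 (Succ s t)"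
    by (rule invariant_fmI[OF weight], erule atom_invariant[OF _ assms])+
qed

text \<open>The pointwise maxima of the thresholds serve both subformulas; \<open>f\<close> stands
  for the connective.\<close>

lemma invariant_fm_binary:
  assumes "invariant_fm V W1 \<phi>1" "invariant_fm V W2 \<phi>2" "W1 + W2 \<le> W"
    and sat: "\<And>N e. sat (lin_order N) e \<phi> = f (sat (lin_order N) e \<phi>1) (sat (lin_order N) e \<phi>2)"
  shows "invariant_fm V W \<phi>"
proof -
  obtain d1 l1 where 1: "(sum d1 V)\<^sup>2 + 2 * l1 \<le> W1\<^sup>2"
    "\<And>N e M e'. thr_equiv V d1 l1 N e M e' \<Longrightarrow> sat (lin_order N) e \<phi>1 = sat (lin_order M) e' \<phi>1"
    using assms(1) unfolding invariant_fm_def by blast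
  obtain d2 l2 where 2: "(sum d2 V)\<^sup>2 + 2 * l2 \<le> W2\<^sup>2"
    "\<And>N e M e'. thr_equiv V d2 l2 N e M e' \<Longrightarrow> sat (lin_order N) e \<phi>2 = sat (lin_order M) e' \<phi>2"
    using assms(2) unfolding invariant_fm_def by blast
  define d where "d = (\<lambda>w. max (d1 w) (d2 w))"
  have "sum d V \<le> sum d1 V + sum d2 V"
    unfolding d_def by (subst sum.distrib[symmetric]) (auto intro: sum_mono)
  then have "(sum d V)\<^sup>2 \<le> (sum d1 V + sum d2 V)\<^sup>2" by (rule power_mono) simp
  \<comment> \<open>This controls the cross term in the square of the sum.\<close>
  moreover have "sum d1 V \<le> W1" "sum d2 V \<le> W2"
    using 1(1) 2(1) power2_nat_le_eq_le add_leD1 by blast+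
  then have "sum d1 V * sum d2 V \<le> W1 * W2" by (rule mult_mono) auto
  ultimately have "(sum d V)\<^sup>2 + 2 * max l1 l2 \<le> (W1 + W2)\<^sup>2"
    using 1(1) 2(1) by (simp add: power2_sum)
  also have "\<dots> \<le> W\<^sup>2" using assms(3) by (rule power_mono) simp
  finally have bound: "(sum d V)\<^sup>2 + 2 * max l1 l2 \<le> W\<^sup>2" .
  have "sat (lin_order N) e \<phi> = sat (lin_order M) e' \<phi>"
    if "thr_equiv V d (max l1 l2) N e M e'" for N e M e'
  proof -
    have "thr_equiv V d1 l1 N e M e'" "thr_equiv V d2 l2 N e M e'"
      by (rule thr_equiv_mono[OF that]; simp add: d_def)+
    then have "sat (lin_order N) e \<phi>1 = sat (lin_order M) e' \<phi>1"
      "sat (lin_order N) e \<phi>2 = sat (lin_order M) e' \<phi>2"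
      by (auto dest: 1(2) 2(2))
    then show ?thesis by (simp add: sat)
  qed
  then show ?thesis by (rule invariant_fmI[OF bound])
qed

lemma invariant_fm_quant:
  assumes "card V = 3" "x \<in> V" "invariant_fm V W \<phi>"
  shows "invariant_fm V (W + 2) (Ex x \<phi>)" "invariant_fm V (W + 2) (All x \<phi>)"
proof -
  obtain d l where dl: "(sum d V)\<^sup>2 + 2 * l \<le> W\<^sup>2"
    "\<And>N e M e'. thr_equiv V d l N e M e' \<Longrightarrow> sat (lin_order N) e \<phi> = sat (lin_order M) e' \<phi>"
    using assms(3) unfolding invariant_fm_def by blast
  define c where "c = sum d V"
  define d' where "d' = quant_centre V x d"
  define l' where "l' = l + c + 1"
  have fin: "finite V" using assms(1) card.infinite by fastforce
  \<comment> \<open>Only the summand at \<open>x\<close> is nonzero, and \<open>d x\<close> as well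
    as \<open>c - d x + 1\<close> are at most \<open>c + 1\<close>.\<close>
  have "sum d' V = max (d x) (sum d (V - {x}) + 1)"
    using fin assms(2) by (simp add: d'_def quant_centre_def[abs_def] sum.delta)
  also have "\<dots> \<le> c + 1"
    using sum.remove[OF fin assms(2), of d] by (simp add: c_def)
  finally have "(sum d' V)\<^sup>2 \<le> (c + 1)\<^sup>2" by (rule power_mono) simp
  also have "\<dots> = c\<^sup>2 + 2 * c + 1" by (simp add: power2_eq_square)
  finally have "(sum d' V)\<^sup>2 \<le> c\<^sup>2 + 2 * c + 1" .
  moreover have "c \<le> W" using dl(1) power2_nat_le_eq_le add_leD1 unfolding c_def by blast
  \<comment> \<open>The new cost is at most \<open>c\<^sup>2 + 2 * l + 4 * c + 3\<close>, and
    \<open>c \<le> W\<close> makes this at most \<open>W\<^sup>2 + 4 * W + 4\<close>.\<close>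
  ultimately have bound: "(sum d' V)\<^sup>2 + 2 * l' \<le> (W + 2)\<^sup>2"
    using dl(1) unfolding l'_def c_def[symmetric] power2_sum by simp
  have forth: "\<exists>b\<le>M. sat (lin_order N) (e(x := a)) \<phi> = sat (lin_order M) (e'(x := b)) \<phi>"
    if "thr_equiv V d' l' N e M e'" "a \<le> N" for N e M e' a
    using thr_equiv_extend[OF assms(1,2), of d l N e M e' a] that dl(2)
    unfolding d'_def l'_def c_def by blast
  have "sat (lin_order N) e (Ex x \<phi>) = sat (lin_order M) e' (Ex x \<phi>)"
    "sat (lin_order N) e (All x \<phi>) = sat (lin_order M) e' (All x \<phi>)"
    if "thr_equiv V d' l' N e M e'" for N e M e'
  proof -
    define S where "S a \<longleftrightarrow> sat (lin_order N) (e(x := a)) \<phi>" for a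
    define T where "T b \<longleftrightarrow> sat (lin_order M) (e'(x := b)) \<phi>" for b
    \<comment> \<open>The back direction is the forth direction for the swapped orders.\<close>
    have "\<forall>a\<le>N. \<exists>b\<le>M. S a = T b" "\<forall>b\<le>M. \<exists>a\<le>N. T b = S a"
      using forth[OF that] forth[OF thr_equiv_sym[OF that]] by (auto simp: S_def T_def)
    then have "(\<exists>a\<le>N. S a) = (\<exists>b\<le>M. T b)" "(\<forall>a\<le>N. S a) = (\<forall>b\<le>M. T b)" by metis+
    then show "sat (lin_order N) e (Ex x \<phi>) = sat (lin_order M) e' (Ex x \<phi>)"
      "sat (lin_order N) e (All x \<phi>) = sat (lin_order M) e' (All x \<phi>)"
      by (auto simp: S_def T_def Bex_def Ball_def)
  qed
  then show "invariant_fm V (W + 2) (Ex x \<phi>)" "invariant_fm V (W + 2) (All x \<phi>)"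
    using invariant_fmI[OF bound] by blast+
qed

lemma invariant_fm_mono: "invariant_fm V W \<phi> \<Longrightarrow> W \<le> W' \<Longrightarrow> invariant_fm V W' \<phi>"
  unfolding invariant_fm_def using power2_nat_le_eq_le[of W W'] le_trans by blast

text \<open>Each node is charged 4: atoms use all of it, quantifiers 2, Boolean connectives
  nothing.\<close>

lemma invariant_fm_size:
  assumes "card V = 3" "fm_vars \<phi> \<subseteq> V"
  shows "invariant_fm V (4 * fm_size \<phi>) \<phi>"
  using assms(2)
proof (induction \<phi>)
  case (Neg \<phi>)
  then have "invariant_fm V (4 * fm_size \<phi>) (Neg \<phi>)" by (simp add: invariant_fm_def)
  then show ?case by (rule invariant_fm_mono) simp
next
  case (Conj \<phi>1 \<phi>2)
  then have "invariant_fm V (4 * fm_size \<phi>1) \<phi>1" "invariant_fm V (4 * fm_size \<phi>2) \<phi>2" by auto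
  then show ?case by (rule invariant_fm_binary[where f = "(\<and>)"]) auto
next
  case (Disj \<phi>1 \<phi>2)
  then have "invariant_fm V (4 * fm_size \<phi>1) \<phi>1" "invariant_fm V (4 * fm_size \<phi>2) \<phi>2" by auto
  then show ?case by (rule invariant_fm_binary[where f = "(\<or>)"]) auto
next
  case (Ex x \<phi>)
  then have "invariant_fm V (4 * fm_size \<phi> + 2) (Ex x \<phi>)"
    using invariant_fm_quant[OF assms(1)] by simp
  then show ?case by (rule invariant_fm_mono) simp
next
  case (All x \<phi>)
  then have "invariant_fm V (4 * fm_size \<phi> + 2) (All x \<phi>)"
    using invariant_fm_quant[OF assms(1)] by simp
  then show ?case by (rule invariant_fm_mono) simp
qed (use assms(1) invariant_fm_atom in auto)

section \<open>Independence of the assignment and constancy of sentences on long orders\<close>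

lemma trm_val_cong: "(\<And>x. x \<in> trm_vars s \<Longrightarrow> e x = e' x) \<Longrightarrow> trm_val A e s = trm_val A e' s"
  by (cases s) simp_all

lemma sat_cong_free_vars:
  "(\<And>x. x \<in> free_vars \<phi> \<Longrightarrow> e x = e' x) \<Longrightarrow> sat A e \<phi> = sat A e' \<phi>"
proof (induction \<phi> arbitrary: e e')
  case (Eq s t)
  have "trm_val A e s = trm_val A e' s" by (rule trm_val_cong) (simp add: Eq.prems)
  moreover have "trm_val A e t = trm_val A e' t" by (rule trm_val_cong) (simp add: Eq.prems)
  ultimately show ?case by simp
next
  case (Less s t)
  have "trm_val A e s = trm_val A e' s" by (rule trm_val_cong) (simp add: Less.prems)
  moreover have "trm_val A e t = trm_val A e' t" by (rule trm_val_cong) (simp add: Less.prems)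
  ultimately show ?case by simp
next
  case (Succ s t)
  have "trm_val A e s = trm_val A e' s" by (rule trm_val_cong) (simp add: Succ.prems)
  moreover have "trm_val A e t = trm_val A e' t" by (rule trm_val_cong) (simp add: Succ.prems)
  ultimately show ?case by simp
next
  case (Neg \<phi>)
  have "sat A e \<phi> = sat A e' \<phi>" by (rule Neg.IH) (simp add: Neg.prems)
  then show ?case by simp
next
  case (Conj \<phi>1 \<phi>2)
  have "sat A e \<phi>1 = sat A e' \<phi>1" by (rule Conj.IH(1)) (simp add: Conj.prems)
  moreover have "sat A e \<phi>2 = sat A e' \<phi>2" by (rule Conj.IH(2)) (simp add: Conj.prems)
  ultimately show ?case by simp
next
  case (Disj \<phi>1 \<phi>2)
  have "sat A e \<phi>1 = sat A e' \<phi>1" by (rule Disj.IH(1)) (simp add: Disj.prems)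
  moreover have "sat A e \<phi>2 = sat A e' \<phi>2" by (rule Disj.IH(2)) (simp add: Disj.prems)
  ultimately show ?case by simp
next
  case (Ex x \<phi>)
  have "sat A (e(x := a)) \<phi> = sat A (e'(x := a)) \<phi>" for a
    by (rule Ex.IH) (simp add: Ex.prems)
  then show ?case by simp
next
  case (All x \<phi>)
  have "sat A (e(x := a)) \<phi> = sat A (e'(x := a)) \<phi>" for a
    by (rule All.IH) (simp add: All.prems)
  then show ?case by simp
qed

lemma models_sentence_iff:
  assumes "free_vars \<phi> = {}" "range e \<subseteq> univ A"
  shows "A \<Turnstile> \<phi> \<longleftrightarrow> sat A e \<phi>"
proof -
  have "sat A e' \<phi> = sat A e \<phi>" for e' by (rule sat_cong_free_vars) (simp add: assms(1))
  then show ?thesis using assms(2) unfolding models_def by blast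
qed

lemma finite_fm_vars: "finite (fm_vars \<phi>)"
proof -
  have "finite (trm_vars s)" for s by (cases s) auto
  then show ?thesis by (induction \<phi>) auto
qed

lemma three_var_sentence_eventually_constant:
  assumes "card (fm_vars \<psi>) \<le> 3" "free_vars \<psi> = {}"
    and NM: "16 * (fm_size \<psi>)\<^sup>2 < N" "16 * (fm_size \<psi>)\<^sup>2 < M"
  shows "lin_order N \<Turnstile> \<psi> \<longleftrightarrow> lin_order M \<Turnstile> \<psi>"
proof -
  \<comment> \<open>Fresh variables pad the variable set to exactly three, as the invariance lemmas
    require.\<close>
  have "infinite (UNIV - fm_vars \<psi>)" using finite_fm_vars by (simp add: Diff_infinite_finite)
  then obtain U where U: "finite U" "card U = 3 - card (fm_vars \<psi>)" "U \<subseteq> UNIV - fm_vars \<psi>"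
    using infinite_arbitrarily_large by blast
  define V where "V = fm_vars \<psi> \<union> U"
  have "card V = card (fm_vars \<psi>) + card U"
    unfolding V_def using U finite_fm_vars by (intro card_Un_disjoint) auto
  then have V: "fm_vars \<psi> \<subseteq> V" "card V = 3" using U(2) assms(1) by (auto simp: V_def)
  obtain d l where dl: "(sum d V)\<^sup>2 + 2 * l \<le> (4 * fm_size \<psi>)\<^sup>2"
    "\<And>N e M e'. thr_equiv V d l N e M e' \<Longrightarrow> sat (lin_order N) e \<psi> = sat (lin_order M) e' \<psi>"
    using invariant_fm_size[OF V(2,1)] unfolding invariant_fm_def by blast
  \<comment> \<open>With all variables at 0, the only nonzero distances are \<open>N\<close> and
    \<open>M\<close>, which exceed every threshold that applies to them.\<close>
  have "2 * l < N" "2 * l < M" using dl(1) NM by (auto simp: power_mult_distrib)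
  then have "thr_equiv V d l N (\<lambda>_. 0) M (\<lambda>_. 0)"
    unfolding thr_equiv_def trms_def by (auto simp: close_def)
  then have "sat (lin_order N) (\<lambda>_. 0) \<psi> = sat (lin_order M) (\<lambda>_. 0) \<psi>" by (rule dl(2))
  then show ?thesis using assms(2) by (simp add: models_sentence_iff[of _ "\<lambda>_. 0"])
qed

section \<open>Defining lengths with two variables\<close>

text \<open>An ascending chain of \<open>n\<close> steps starting at \<open>v\<close>. The variables
  0 and 1 alternate, each step reusing the one no longer needed; the trivial equation serves as
  truth.\<close>

fun above_fm :: "nat \<Rightarrow> nat \<Rightarrow> fm" where
  "above_fm 0 v = Eq (Var v) (Var v)"
| "above_fm (Suc n) v = Ex (1 - v) (Conj (Less (Var v) (Var (1 - v))) (above_fm n (1 - v)))"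

definition at_least_fm :: "nat \<Rightarrow> fm" where
  "at_least_fm n = Ex 0 (above_fm n 0)"

text \<open>An if-else chain from the longest case down: the first \<open>at_least_fm n\<close> that
  holds decides. Building \<open>P\<close> into the choice of connective lets the rest of the chain
  occur only once. The last test \<open>at_least_fm 0\<close> is always true.\<close>

fun length_cases_fm :: "(nat \<Rightarrow> bool) \<Rightarrow> nat \<Rightarrow> fm" where
  "length_cases_fm P 0 = (if P 0 then at_least_fm 0 else Neg (at_least_fm 0))"
| "length_cases_fm P (Suc n) =
    (if P (Suc n) then Disj (at_least_fm (Suc n)) (length_cases_fm P n)
     else Conj (Neg (at_least_fm (Suc n))) (length_cases_fm P n))"

lemma sat_above_fm: "v \<le> 1 \<Longrightarrow> e v \<le> N \<Longrightarrow> sat (lin_order N) e (above_fm n v) \<longleftrightarrow> e v + n \<le> N"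
proof (induction n arbitrary: v e)
  case (Suc n)
  have "1 - v \<noteq> v" using Suc.prems(1) by presburger
  then have "sat (lin_order N) e (above_fm (Suc n) v) \<longleftrightarrow> (\<exists>a\<le>N. e v < a \<and> a + n \<le> N)"
    using Suc by (auto simp: Bex_def)
  also have "\<dots> \<longleftrightarrow> e v + Suc n \<le> N"
    by (auto intro: exI[of _ "Suc (e v)"])
  finally show ?case .
qed simp

lemma sat_at_least_fm: "sat (lin_order N) e (at_least_fm n) \<longleftrightarrow> n \<le> N"
  by (auto simp: at_least_fm_def sat_above_fm intro: bexI[of _ 0])

lemma sat_length_cases_fm: "sat (lin_order N) e (length_cases_fm P K) \<longleftrightarrow> P (min N K)"
proof (induction K)
  case (Suc K)
  show ?case
  proof (cases "Suc K \<le> N")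
    case True
    then show ?thesis by (auto simp: sat_at_least_fm min_def)
  next
    case False
    then have "min N (Suc K) = min N K" by simp
    then show ?thesis using Suc False by (simp add: sat_at_least_fm)
  qed
qed (simp add: sat_at_least_fm)

lemma above_fm_syntax:
  "fm_size (above_fm n v) = 3 * n + 1"
  "v \<le> 1 \<Longrightarrow> fm_vars (above_fm n v) \<subseteq> {0, 1}"
  "free_vars (above_fm n v) \<subseteq> {v}"
  "fm_symbols (above_fm n v) \<subseteq> {LessSym}"
proof (induction n arbitrary: v)
  case (Suc n)
  {
    case 1
    show ?case using Suc(1) by simp
  next
    case 2
    then have "v \<in> {0, 1}" "1 - v \<in> {0, 1}" by auto
    then show ?case using Suc(2)[of "1 - v"] by auto
  next
    case 3
    show ?case using Suc(3)[of "1 - v"] by auto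
  next
    case 4
    show ?case using Suc(4)[of "1 - v"] by auto
  }
qed auto

lemma length_cases_fm_in_FO2: "length_cases_fm P K \<in> FO_sentences 2 {LessSym}"
proof -
  have at_least: "fm_vars (at_least_fm n) \<subseteq> {0, 1}" "free_vars (at_least_fm n) = {}"
    "fm_symbols (at_least_fm n) \<subseteq> {LessSym}" for n
    using above_fm_syntax(2-)[where v = 0 and n = n] by (auto simp: at_least_fm_def)
  have "fm_vars (length_cases_fm P K) \<subseteq> {0, 1}" "free_vars (length_cases_fm P K) = {}"
    "fm_symbols (length_cases_fm P K) \<subseteq> {LessSym}"
    using at_least by (induction K) auto
  moreover from this(1) have "card (fm_vars (length_cases_fm P K)) \<le> card {0, 1 :: nat}"
    by (intro card_mono) auto
  ultimately show ?thesis by (simp add: FO_sentences_def FO_formulas_def)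
qed

text \<open>Each of the \<open>K + 1\<close> cases consists of a test of size
  \<open>3 * n + 2\<close> and at most a negation and a connective.\<close>

lemma fm_size_length_cases_fm: "fm_size (length_cases_fm P K) \<le> (K + 1) * (3 * K + 4)"
  by (induction K) (auto simp: at_least_fm_def above_fm_syntax(1) algebra_simps)

section \<open>Choice of the cutoff and the resulting size bound\<close>

theorem theorem4p3:
  shows "\<exists>f :: nat \<Rightarrow> nat.
    (\<lambda>m. real (f m)) \<in> O(\<lambda>m. real m ^ 4) \<and>
    (\<forall>\<psi> \<in> FO_sentences 3 {LessSym, SuccSym, MinSym, MaxSym}.
      \<exists>\<chi> \<in> FO_sentences 2 {LessSym}.
        fm_size \<chi> \<le> f (fm_size \<psi>) \<and>
        (\<forall>N :: nat. lin_order N \<Turnstile> \<chi> \<longleftrightarrow> lin_order N \<Turnstile> \<psi>))"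
proof -
  \<comment> \<open>The least length in the range where the truth value is constant, so the case of
    length \<open>K\<close> answers for all longer orders.\<close>
  define K where "K m = 16 * m\<^sup>2 + 1" for m :: nat
  define f where "f m = (K m + 1) * (3 * K m + 4)" for m
  have "f m \<le> 990 * m ^ 4" if "1 \<le> m" for m
  proof -
    have "1 \<le> m\<^sup>2" using that by simp
    \<comment> \<open>The factors are \<open>16 * m\<^sup>2 + 2\<close> and
      \<open>48 * m\<^sup>2 + 7\<close>, and \<open>1 \<le> m\<^sup>2\<close> absorbs the
      constants.\<close>
    then have "f m \<le> (18 * m\<^sup>2) * (55 * m\<^sup>2)"
      unfolding f_def K_def by (intro mult_mono) auto
    also have "\<dots> = 990 * m ^ 4" by (simp add: power2_eq_square power4_eq_xxxx)
    finally show ?thesis .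
  qed
  then have "real (f m) \<le> 990 * real m ^ 4" if "1 \<le> m" for m
    using that by (metis of_nat_le_iff of_nat_mult of_nat_numeral of_nat_power)
  then have "(\<lambda>m. real (f m)) \<in> O(\<lambda>m. real m ^ 4)"
    by (intro bigoI[where c = 990]) (auto intro: eventually_sequentiallyI[of 1])
  moreover have "\<exists>\<chi> \<in> FO_sentences 2 {LessSym}. fm_size \<chi> \<le> f (fm_size \<psi>) \<and>
      (\<forall>N :: nat. lin_order N \<Turnstile> \<chi> \<longleftrightarrow> lin_order N \<Turnstile> \<psi>)"
    if \<psi>: "\<psi> \<in> FO_sentences 3 {LessSym, SuccSym, MinSym, MaxSym}" for \<psi>
  proof -
    let ?K = "K (fm_size \<psi>)"
    let ?\<chi> = "length_cases_fm (\<lambda>n. lin_order n \<Turnstile> \<psi>) ?K"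
    have \<psi>': "card (fm_vars \<psi>) \<le> 3" "free_vars \<psi> = {}"
      using \<psi> by (auto simp: FO_sentences_def FO_formulas_def)
    have "lin_order N \<Turnstile> ?\<chi> \<longleftrightarrow> lin_order N \<Turnstile> \<psi>" for N
    proof -
      have "lin_order N \<Turnstile> ?\<chi> \<longleftrightarrow> lin_order (min N ?K) \<Turnstile> \<psi>"
        \<comment> \<open>The zero assignment ensures that the quantifier over assignments in
          \<open>models\<close> is not vacuous.\<close>
        unfolding models_def[of "lin_order N" "?\<chi>"] sat_length_cases_fm
        by (auto intro: exI[of _ "\<lambda>_. 0"])
      also have "\<dots> \<longleftrightarrow> lin_order N \<Turnstile> \<psi>"
      proof (cases "N \<le> ?K")
        case False
        then show ?thesis
          using three_var_sentence_eventually_constant[OF \<psi>', of N ?K] by (simp add: K_def)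
      qed simp
      finally show ?thesis .
    qed
    then show ?thesis
      using length_cases_fm_in_FO2 fm_size_length_cases_fm unfolding f_def by blast
  qed
  ultimately show ?thesis by blast
qed

end
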